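(* Let $n\ge 2$ be an integer and let $z\in\mathbb{C}\setminus\mathbb{R}$ satisfy $|z|^2=n$ and the periodicity condition $z^2\in\mathbb{Z}+z\mathbb{Z}$. Put $D:=2\,\mathrm{Re}(z)$, which is an integer with $-2\sqrt n<D<2\sqrt n$ (so that $z^2=Dz-n$). Then the numeral system $(n,z)$ is proper if and only if $D\le 1$.
   Context: Let $\bar n=\{0,1,\dots,n-1\}$ be the set of digits. A representation of $x\in\mathbb{C}$ in the system $(n,z)$ is a two-sided sequence $(a_i)_{i\in\mathbb{Z}}$ with $a_i\in\bar n$ for all $i$, with $a_i=0$ for all sufficiently large $i$ (i.e. there is $N$ such that $a_i=0$ for all $i>N$), and with $\sum_{i\in\mathbb{Z}}a_iz^i=x$. The system $(n,z)$ is called proper if every $x\in\mathbb{C}$ has at least one representation, and there is a set $S\subset\mathbb{C}$ of two-dimensional Lebesgue measure $0$ such that every $x\in\mathbb{C}\setminus S$ has at most one representation. *)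

theory Defs
  imports "HOL-Analysis.Analysis"
begin

text \<open>
  A representation of \<open>x\<close> in the system \<open>(n, z)\<close> is a two-sided digit sequence, indexed by the
  integers. The sum over all integer exponents is the unordered sum \<open>has_sum\<close>. For \<open>\<bar>z\<bar> > 1\<close> every
  admissible digit sequence gives an absolutely convergent series, so the order of summation is
  immaterial.
\<close>

definition is_representation :: "nat \<Rightarrow> complex \<Rightarrow> complex \<Rightarrow> (int \<Rightarrow> nat) \<Rightarrow> bool" where
  "is_representation n z x a \<longleftrightarrow>
     (\<forall>i. a i \<in> {0..<n}) \<and>
     (\<exists>N. \<forall>i>N. a i = 0) \<and>
     ((\<lambda>i. of_nat (a i) * z powi i) has_sum x) UNIV"

definition proper_system :: "nat \<Rightarrow> complex \<Rightarrow> bool" where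
  "proper_system n z \<longleftrightarrow>
     (\<forall>x. \<exists>a. is_representation n z x a) \<and>
     (\<exists>S \<in> null_sets (lebesgue :: complex measure).
        \<forall>x. x \<notin> S \<longrightarrow>
          (\<forall>a b. is_representation n z x a \<longrightarrow> is_representation n z x b \<longrightarrow> a = b))"

end

theory Submission
  imports Defs
begin

text \<open>
  Let \<open>L = \<int> + \<int>z\<close> and let the tile \<open>T\<close> be the compact set of all \<open>\<Sum>k\<ge>1. c\<^sub>k z\<^sup>-\<^sup>k\<close> with digits
  \<open>c\<^sub>k < n\<close>. Multiplication by \<open>z\<close> scales areas by \<open>n\<close>, while \<open>z T\<close> is the union of the \<open>n\<close> translates
  \<open>T + d\<close>; so these translates overlap only in null sets, which yields uniqueness almost everywhere
  for every \<open>D\<close>. The digits represent \<open>L / z L\<close>, whence \<open>T + L\<close> is everything, and existence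
  holds as soon as every element of \<open>L\<close> is a finite sum \<open>\<Sum>i<m. e\<^sub>i z\<^sup>i\<close>. For \<open>D \<le> 1\<close> this follows from
  Brunotte's argument: a finite set of carries containing generators of \<open>L\<close> is closed under the
  division algorithm.

  For \<open>D \<ge> 2\<close> the element \<open>x\<^sub>0 = 1 - D + z\<close> satisfies \<open>x\<^sub>0 = (n + 1 - D) + z x\<^sub>0\<close>, so it has no finite
  expansion. Complementing every other digit identifies the tile of \<open>z\<close> with a translate of the tile
  of \<open>- z\<close>, and \<open>- z\<close> falls under the first case. So almost no point of \<open>x\<^sub>0 + T\<close> lies in another
  translate \<open>l + T\<close>, \<open>l \<in> L\<close>, and these points have no representation.
\<close>

section \<open>Area in the complex plane under multiplication\<close>

text \<open>Both measures give a box the product of its side lengths, and values on boxes determine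
  Lebesgue measure. This carries the determinant formula for linear maps of \<open>real^2\<close>
  over to \<open>complex\<close>.\<close>

lemma lborel_complex_distr: "distr lborel borel (\<lambda>v::real^2. Complex (v $ 1) (v $ 2)) = lborel"
proof (rule lborel_eqI[symmetric])
  have m: "(\<lambda>v::real^2. Complex (v $ 1) (v $ 2)) \<in> borel_measurable borel"
    by (simp add: borel_measurable_complex_iff)
  have basis: "(Basis :: (real^2) set) = {axis 1 1, axis 2 1}"
    by (auto simp: Basis_vec_def UNIV_2)
  fix l u :: complex
  assume le: "\<And>b. b \<in> Basis \<Longrightarrow> l \<bullet> b \<le> u \<bullet> b"
  have pre: "(\<lambda>v::real^2. Complex (v $ 1) (v $ 2)) -` box l u = box (vector [Re l, Im l]) (vector [Re u, Im u])"
    by (auto simp: mem_box_cart box_complex_eq in_box_complex_iff forall_2)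
  have pos: "Re l \<le> Re u" "Im l \<le> Im u"
    using le[of 1] le[of \<i>] by (auto simp: Basis_complex_def)
  have "emeasure (distr lborel borel (\<lambda>v::real^2. Complex (v $ 1) (v $ 2))) (box l u)
        = emeasure lborel (box (vector [Re l, Im l]) (vector [Re u, Im u]) :: (real^2) set)"
    using m pre by (subst emeasure_distr) auto
  also have "\<dots> = ennreal (prod (\<lambda>b. (vector [Re u, Im u] - vector [Re l, Im l] :: real^2) \<bullet> b) Basis)"
    by (rule emeasure_lborel_box) (use pos in \<open>auto simp: basis inner_axis\<close>)
  also have "prod (\<lambda>b. (vector [Re u, Im u] - vector [Re l, Im l] :: real^2) \<bullet> b) Basis
     = (\<Prod>b\<in>Basis. (u - l) \<bullet> b)"
    by (simp add: basis Basis_complex_def inner_axis axis_eq_axis)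
  finally show "emeasure (distr lborel borel (\<lambda>v::real^2. Complex (v $ 1) (v $ 2))) (box l u)
     = ennreal (\<Prod>b\<in>Basis. (u - l) \<bullet> b)" .
qed simp

text \<open>As a real linear map, multiplication by \<open>z\<close> has the matrix with rows
  \<open>(Re z, - Im z)\<close> and \<open>(Im z, Re z)\<close>, whose determinant is the squared
  modulus.\<close>

lemma measure_mult_complex:
  fixes A :: "complex set"
  assumes "compact A"
  shows "measure lebesgue ((*) z ` A) = (cmod z)\<^sup>2 * measure lebesgue A"
proof -
  define \<phi> :: "real^2 \<Rightarrow> complex" where "\<phi> v = Complex (v $ 1) (v $ 2)" for v
  define \<psi> :: "complex \<Rightarrow> real^2" where "\<psi> w = vector [Re w, Im w]" for w
  have inv: "\<phi> (\<psi> w) = w" "\<psi> (\<phi> v) = v" for v w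
    by (auto simp: \<phi>_def \<psi>_def vec_eq_iff forall_2)
  have m: "\<phi> \<in> borel_measurable borel"
    unfolding \<phi>_def by (simp add: borel_measurable_complex_iff)
  have lin: "linear \<psi>"
    unfolding \<psi>_def by (rule linearI) (auto simp: vec_eq_iff forall_2)
  have transfer: "measure lebesgue B = measure lebesgue (\<psi> ` B)" if "compact B" for B
  proof -
    have c: "compact (\<psi> ` B)"
      using that lin by (intro compact_continuous_image linear_continuous_on) (auto simp: linear_conv_bounded_linear)
    have "\<phi> -` B = \<psi> ` B"
      using inv(2)[symmetric] by (auto simp: inv(1) intro: image_eqI)
    moreover have "measure lborel B = measure lborel (\<phi> -` B)"
      using m that unfolding lborel_complex_distr[symmetric, folded \<phi>_def]
      by (subst measure_distr) (auto intro: borel_compact)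
    ultimately show ?thesis
      using that c by (simp add: measure_completion borel_compact)
  qed
  define f where "f = \<psi> \<circ> (*) z \<circ> \<phi>"
  have linf: "linear f"
    unfolding f_def \<phi>_def \<psi>_def
    by (rule linearI) (auto simp: vec_eq_iff forall_2 algebra_simps)
  have "det (matrix f) = (cmod z)\<^sup>2"
    unfolding cmod_power2
    by (simp add: det_2 matrix_def f_def \<phi>_def \<psi>_def axis_def power2_eq_square)
  moreover have "f ` \<psi> ` A = \<psi> ` (*) z ` A"
    by (simp add: f_def image_comp inv o_def)
  moreover have "compact (\<psi> ` A)"
    using assms lin by (intro compact_continuous_image linear_continuous_on) (auto simp: linear_conv_bounded_linear)
  moreover have "compact ((*) z ` A)"
    using assms by (intro compact_continuous_image continuous_intros)
  ultimately show ?thesis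
    using assms transfer measure_lebesgue_linear_transformation[OF _ _ linf, of "\<psi> ` A"]
    by (simp add: compact_imp_bounded borel_compact)
qed

section \<open>Finite expansions of lattice elements by division with remainder\<close>

text \<open>
  The pair \<open>(a, b)\<close> stands for \<open>a + b z\<close> with \<open>z\<^sup>2 = D z - n\<close>. The pair in the premise of \<open>step\<close> is
  \<open>(a + b z - a mod n) / z\<close>, so that the digits are read off from the least significant end.
\<close>
inductive finite_expansion :: "int \<Rightarrow> int \<Rightarrow> int \<Rightarrow> int \<Rightarrow> bool" for n D :: int where
  zero: "finite_expansion n D 0 0"
| step: "finite_expansion n D (b + (a div n) * D) (- (a div n)) \<Longrightarrow> finite_expansion n D a b"

text \<open>
  The members of \<open>V\<close> act as carries: adding one of them before a division step by \<open>z\<close>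
  amounts to adding another one afterwards.
\<close>
lemma finite_expansion_add:
  assumes "0 < n"
    and closed: "\<forall>(u, v)\<in>V. \<forall>r\<in>{0..<n}. (v + ((u + r) div n) * D, - ((u + r) div n)) \<in> V"
    and V: "\<forall>(u, v)\<in>V. finite_expansion n D u v"
    and "finite_expansion n D a b"
  shows "(u, v) \<in> V \<Longrightarrow> finite_expansion n D (a + u) (b + v)"
  using assms(4)
proof (induction arbitrary: u v)
  case zero
  from bspec[OF V this] show ?case by simp
next
  case (step b a)
  \<comment> \<open>\<open>q\<close> is the carry out of the lowest digit. The quotient pair of the
    sum is the quotient pair of \<open>(a, b)\<close> plus \<open>(v + q * D, - q)\<close>, which
    lies in \<open>V\<close> again, so the induction hypothesis applies.\<close>
  define q where "q = (u + a mod n) div n"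
  have "(a + u) div n = ((u + a mod n) + (a div n) * n) div n"
    by (simp add: algebra_simps)
  also have "\<dots> = a div n + q"
    using \<open>0 < n\<close> by (subst div_mult_self1) (auto simp: q_def)
  finally have q: "(a + u) div n = a div n + q" .
  have "a mod n \<in> {0..<n}" using \<open>0 < n\<close> by simp
  with bspec[OF closed step.prems] have "(v + q * D, - q) \<in> V"
    unfolding q_def prod.case by (rule bspec)
  from step.IH[OF this] have "finite_expansion n D (b + v + (a + u) div n * D) (- ((a + u) div n))"
    by (simp add: q algebra_simps)
  then show ?case by (rule finite_expansion.step)
qed

text \<open>Starting from zero, \<open>(c, 1)\<close> or its negative is added until the second
  coordinate is \<open>b\<close>; then \<open>(1, 0)\<close> or its negative corrects the first.
  Negatives are listed because only addition is available.\<close>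

lemma finite_expansion_from_generators:
  assumes "0 < n"
    and closed: "\<forall>(u, v)\<in>V. \<forall>r\<in>{0..<n}. (v + ((u + r) div n) * D, - ((u + r) div n)) \<in> V"
    and V: "\<forall>(u, v)\<in>V. finite_expansion n D u v"
    and gen: "(1, 0) \<in> V" "(- 1, 0) \<in> V" "(c, 1) \<in> V" "(- c, - 1) \<in> V"
  shows "finite_expansion n D a b"
proof -
  note add = finite_expansion_add[OF assms(1-3)]
  have mult: "finite_expansion n D (a + int k * u) (b + int k * v)"
    if "finite_expansion n D a b" "(u, v) \<in> V" for a b u v k
  proof (induction k)
    case (Suc k)
    from add[OF Suc.IH that(2)] show ?case by (simp add: algebra_simps)
  qed (use that in simp)
  have "finite_expansion n D (b * c) b"
  proof (cases "b \<ge> 0")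
    case True
    then show ?thesis using mult[OF zero gen(3), of "nat b"] by simp
  next
    case False
    then show ?thesis using mult[OF zero gen(4), of "nat (- b)"] by simp
  qed
  then show ?thesis
    using mult[OF _ gen(1), of "b * c" b "nat (a - b * c)"]
      mult[OF _ gen(2), of "b * c" b "nat (b * c - a)"]
    by (cases "a \<ge> b * c") auto
qed

text \<open>In each case \<open>V\<close> consists of the pairs reached from \<open>(1, 0)\<close>
  by repeated carrying. The hypotheses keep their first coordinates between \<open>- n\<close> and
  \<open>n\<close>, so every carry is \<open>- 1\<close>, \<open>0\<close> or \<open>1\<close>. The
  shape of \<open>V\<close> varies because the sign of \<open>D\<close> decides which carries
  occur.\<close>

lemma finite_expansion_all:
  fixes n D :: int
  assumes "2 \<le> n" "D \<le> 1" "- D \<le> n"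
  shows "finite_expansion n D a b"
proof -
  have dv: "x div n = (if x < 0 then - 1 else if x < n then 0 else 1)"
    if "- n \<le> x" "x < 2 * n" for x
  proof -
    have "(x + n) div n = 0" if "x < 0"
      using that \<open>- n \<le> x\<close> by (intro div_pos_pos_trivial) auto
    moreover have "(x - n) div n = 0" if "x \<ge> n"
      using that \<open>x < 2 * n\<close> by (intro div_pos_pos_trivial) auto
    moreover have "(x + n) div n = x div n + 1" "(x - n) div n = x div n - 1"
      using assms(1) div_mult_self1[of n x 1] div_mult_self1[of n x "-1"] by simp_all
    ultimately show ?thesis using that by auto
  qed
  \<comment> \<open>A division step read backwards: \<open>(a', b')\<close> is the quotient pair of
    \<open>(a, b)\<close> and \<open>q\<close> its carry. Below, members of \<open>V\<close> are
    settled in an order in which each quotient pair comes first.\<close>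
  have st: "finite_expansion n D a b"
    if "finite_expansion n D a' b'" "q = (if a < 0 then - 1 else if a < n then 0 else 1)"
      "a' = b + q * D" "b' = - q" "- n \<le> a" "a < 2 * n" for a b a' b' q
  proof -
    have "finite_expansion n D (b + (a div n) * D) (- (a div n))"
      using that by (simp add: dv)
    then show ?thesis by (rule step)
  qed
  have base: "finite_expansion n D 1 0"
    by (rule st[OF zero, where q = 0]) (use assms(1) in auto)
  consider "D \<le> - 1" | "D = 0" | "D = 1" using assms by linarith
  then show ?thesis
  proof cases
    case 1
    define V :: "(int \<times> int) set"
      where "V = {(0, 0), (1, 0), (- 1, 0), (- D, 1), (D, - 1), (- D - 1, 1), (D + 1, - 1)}"
    have s1: "finite_expansion n D (- D - 1) 1"
      by (rule st[OF base, where q = 0]) (use 1 assms in auto)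
    have s2: "finite_expansion n D D (- 1)"
      by (rule st[OF s1, where q = "- 1"]) (use 1 assms in auto)
    \<comment> \<open>For \<open>D = - 1\<close> the first coordinate is \<open>0\<close>, and the
      quotient pair becomes \<open>(- 1, 0)\<close>, which is settled only in
      \<open>s5\<close>.\<close>
    have s3: "finite_expansion n D (D + 1) (- 1)" if "D \<noteq> - 1"
      by (rule st[OF s1, where q = "- 1"]) (use 1 assms that in auto)
    have s4: "finite_expansion n D (- D) 1"
    proof (cases "- D < n")
      case True
      show ?thesis by (rule st[OF base, where q = 0]) (use 1 assms True in auto)
    next
      \<comment> \<open>Here \<open>- D = n\<close>, so the digit is \<open>0\<close>, the carry is
        \<open>1\<close> and the quotient pair is \<open>(D + 1, - 1)\<close>.\<close>
      case False
      with assms have "D \<noteq> - 1" by auto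
      from s3[OF this] show ?thesis
        by (rule st[where q = 1]) (use 1 assms False in auto)
    qed
    have s5: "finite_expansion n D (- 1) 0"
      by (rule st[OF s4, where q = "- 1"]) (use 1 assms in auto)
    have s6: "finite_expansion n D (D + 1) (- 1)"
    proof (cases "D = - 1")
      case True
      show ?thesis by (rule st[OF s5, where q = 0]) (use assms True in auto)
    qed (use s3 in auto)
    have cl: "(v + (u + r) div n * D, - ((u + r) div n)) \<in> V"
      if "(u, v) \<in> V" "r \<in> {0..<n}" for u v r
    proof -
      have "(u + r) div n = (if u + r < 0 then - 1 else if u + r < n then 0 else 1)"
        using that 1 assms by (intro dv) (auto simp: V_def)
      then show ?thesis
        using that 1 assms unfolding V_def by auto
    qed
    have closed: "\<forall>(u, v)\<in>V. \<forall>r\<in>{0..<n}. (v + (u + r) div n * D, - ((u + r) div n)) \<in> V"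
      by (safe, erule cl)
    have fin: "\<forall>(u, v)\<in>V. finite_expansion n D u v"
      unfolding V_def using zero base s1 s2 s4 s5 s6 by blast
    show ?thesis
      by (rule finite_expansion_from_generators[OF _ closed fin, where c = "- D"])
        (use assms(1) in \<open>auto simp: V_def\<close>)
  next
    case 2
    define V :: "(int \<times> int) set" where "V = {(0, 0), (1, 0), (- 1, 0), (0, 1), (0, - 1)}"
    have s1: "finite_expansion n D 0 1"
      by (rule st[OF base, where q = 0]) (use 2 assms in auto)
    have s2: "finite_expansion n D (- 1) 0"
      by (rule st[OF s1, where q = "- 1"]) (use 2 assms in auto)
    have s3: "finite_expansion n D 0 (- 1)"
      by (rule st[OF s2, where q = 0]) (use 2 assms in auto)
    have cl: "(v + (u + r) div n * D, - ((u + r) div n)) \<in> V"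
      if "(u, v) \<in> V" "r \<in> {0..<n}" for u v r
    proof -
      have "(u + r) div n = (if u + r < 0 then - 1 else if u + r < n then 0 else 1)"
        using that 2 assms by (intro dv) (auto simp: V_def)
      then show ?thesis
        using that 2 assms unfolding V_def by auto
    qed
    have closed: "\<forall>(u, v)\<in>V. \<forall>r\<in>{0..<n}. (v + (u + r) div n * D, - ((u + r) div n)) \<in> V"
      by (safe, erule cl)
    have fin: "\<forall>(u, v)\<in>V. finite_expansion n D u v"
      unfolding V_def using zero base s1 s2 s3 by blast
    show ?thesis
      by (rule finite_expansion_from_generators[OF _ closed fin, where c = 0])
        (use assms(1) in \<open>auto simp: V_def\<close>)
  next
    case 3
    define V :: "(int \<times> int) set"
      where "V = {(0, 0), (1, 0), (- 1, 0), (1, - 1), (- 1, 1), (0, 1), (0, - 1)}"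
    have s1: "finite_expansion n D 0 1"
      by (rule st[OF base, where q = 0]) (use 3 assms in auto)
    have s2: "finite_expansion n D (- 1) 1"
      by (rule st[OF s1, where q = "- 1"]) (use 3 assms in auto)
    have s3: "finite_expansion n D (- 1) 0"
      by (rule st[OF s2, where q = "- 1"]) (use 3 assms in auto)
    have s4: "finite_expansion n D 0 (- 1)"
      by (rule st[OF s3, where q = 0]) (use 3 assms in auto)
    have s5: "finite_expansion n D 1 (- 1)"
      by (rule st[OF s3, where q = 0]) (use 3 assms in auto)
    have cl: "(v + (u + r) div n * D, - ((u + r) div n)) \<in> V"
      if "(u, v) \<in> V" "r \<in> {0..<n}" for u v r
    proof -
      have "(u + r) div n = (if u + r < 0 then - 1 else if u + r < n then 0 else 1)"
        using that 3 assms by (intro dv) (auto simp: V_def)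
      then show ?thesis
        using that 3 assms unfolding V_def by auto
    qed
    have closed: "\<forall>(u, v)\<in>V. \<forall>r\<in>{0..<n}. (v + (u + r) div n * D, - ((u + r) div n)) \<in> V"
      by (safe, erule cl)
    have fin: "\<forall>(u, v)\<in>V. finite_expansion n D u v"
      unfolding V_def using zero base s1 s2 s3 s4 s5 by blast
    show ?thesis
      by (rule finite_expansion_from_generators[OF _ closed fin, where c = 0])
        (use assms(1) in \<open>auto simp: V_def\<close>)
  qed
qed

section \<open>The lattice and division by \<open>z\<close>\<close>

definition fractional_value :: "complex \<Rightarrow> (nat \<Rightarrow> nat) \<Rightarrow> complex" where
  "fractional_value z c = (\<Sum>k. of_nat (c k) / z ^ Suc k)"

definition tile :: "nat \<Rightarrow> complex \<Rightarrow> complex set" where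
  "tile n z = {fractional_value z c | c. \<forall>k. c k < n}"

definition lattice :: "complex \<Rightarrow> complex set" where
  "lattice z = {of_int a + of_int b * z | a b. True}"

text \<open>The assumptions are invariant under passing from \<open>z\<close>, \<open>D\<close> to
  \<open>- z\<close>, \<open>- D\<close>, so every result below can also be applied to the base
  \<open>- z\<close>.\<close>

locale quadratic_base =
  fixes n :: nat and z :: complex and D :: int
  assumes n_ge_2: "2 \<le> n"
    and Im_nz: "Im z \<noteq> 0"
    and cmod_sq: "(cmod z)\<^sup>2 = real n"
    and square: "z\<^sup>2 = of_int D * z - of_nat n"
begin

lemma z_nz: "z \<noteq> 0"
  using Im_nz by auto

lemma cmod_gt_1: "1 < cmod z"
proof (rule ccontr)
  assume "\<not> ?thesis"
  then have "(cmod z)\<^sup>2 \<le> 1" by (simp add: abs_square_le_1)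
  then show False using cmod_sq n_ge_2 by simp
qed

lemma D_eq: "real_of_int D = 2 * Re z"
proof -
  have "Im (z\<^sup>2) = Im (of_int D * z - of_nat n)" by (simp add: square)
  then have "2 * Re z * Im z = real_of_int D * Im z" by (simp add: power2_eq_square)
  then show ?thesis using Im_nz by simp
qed

lemma D_sq_less: "D\<^sup>2 < 4 * int n"
proof -
  have "0 < (Im z)\<^sup>2" using Im_nz by simp
  with cmod_sq have "(Re z)\<^sup>2 < real n" unfolding cmod_power2 by linarith
  then have "(real_of_int D)\<^sup>2 < 4 * real n" by (simp add: D_eq power_mult_distrib)
  then have "real_of_int (D\<^sup>2) < real_of_int (4 * int n)" by simp
  then show ?thesis by linarith
qed

text \<open>Follows from \<open>4 * n \<le> (n + 1)\<^sup>2\<close>. This is the bound that keeps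
  carries small.\<close>

lemma abs_D_le: "\<bar>D\<bar> \<le> int n"
proof (rule ccontr)
  assume "\<not> ?thesis"
  then have "(int n + 1)\<^sup>2 \<le> \<bar>D\<bar>\<^sup>2" by (intro power_mono) auto
  then have "(int n + 1)\<^sup>2 < 4 * int n" using D_sq_less by simp
  moreover have "0 \<le> (int n - 1)\<^sup>2" by simp
  ultimately show False by (simp add: power2_eq_square algebra_simps)
qed

lemma lattice_mult: "z * (of_int p + of_int q * z) = of_int (- q * int n) + of_int (p + q * D) * z"
proof -
  have "z * (of_int p + of_int q * z) = of_int p * z + of_int q * z\<^sup>2"
    by (simp add: power2_eq_square algebra_simps)
  then show ?thesis by (simp add: square algebra_simps)
qed

lemma lattice_inject:
  "of_int a + of_int b * z = of_int c + of_int d * z \<longleftrightarrow> a = c \<and> b = d"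
proof
  assume eq: "of_int a + of_int b * z = of_int c + of_int d * z"
  from arg_cong[OF eq, of Im] have "b = d" using Im_nz by simp
  moreover from this eq have "a = c" by simp
  ultimately show "a = c \<and> b = d" by simp
qed simp

lemma lattice_times: "x \<in> lattice z \<Longrightarrow> z * x \<in> lattice z"
  unfolding lattice_def using lattice_mult by blast

lemma lattice_add: "x \<in> lattice z \<Longrightarrow> y \<in> lattice z \<Longrightarrow> x + y \<in> lattice z"
proof -
  assume "x \<in> lattice z" "y \<in> lattice z"
  then obtain a b c d where "x = of_int a + of_int b * z" "y = of_int c + of_int d * z"
    unfolding lattice_def by blast
  then have "x + y = of_int (a + c) + of_int (b + d) * z" by (simp add: algebra_simps)
  then show ?thesis unfolding lattice_def by blast
qed

lemma lattice_of_int: "of_int a \<in> lattice z"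
  unfolding lattice_def by (auto intro: exI[of _ a] exI[of _ 0])

lemma lattice_of_nat: "of_nat k \<in> lattice z"
  using lattice_of_int[of "int k"] by simp

lemma lattice_digit_sum: "(\<Sum>i<m. of_nat (e i) * z ^ i) \<in> lattice z"
proof (induction m arbitrary: e)
  case 0
  show ?case using lattice_of_nat[of 0] by simp
next
  case (Suc m)
  have "(\<Sum>i<Suc m. of_nat (e i) * z ^ i) = of_nat (e 0) + z * (\<Sum>i<m. of_nat (e (Suc i)) * z ^ i)"
    by (subst sum.lessThan_Suc_shift) (simp add: sum_distrib_left algebra_simps)
  then show ?case using Suc.IH[of "\<lambda>i. e (Suc i)"]
    by (simp add: lattice_add lattice_of_nat lattice_times)
qed

lemma countable_lattice: "countable (lattice z)"
proof -
  have "lattice z = (\<lambda>(a, b). of_int a + of_int b * z) ` (UNIV :: (int \<times> int) set)"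
    unfolding lattice_def by auto
  then show ?thesis by simp
qed

text \<open>The imaginary part bounds \<open>b\<close>, since \<open>Im z\<close> is nonzero; the
  modulus then bounds \<open>a\<close>.\<close>

lemma finite_lattice_cball: "finite {q \<in> lattice z. cmod q \<le> R}"
proof -
  define B where "B = \<lceil>R / \<bar>Im z\<bar>\<rceil>"
  define A where "A = \<lceil>R + real_of_int B * cmod z\<rceil>"
  have "{q \<in> lattice z. cmod q \<le> R} \<subseteq>
    (\<lambda>(a, b). of_int a + of_int b * z) ` ({- A..A} \<times> {- B..B})"
  proof
    fix q assume "q \<in> {q \<in> lattice z. cmod q \<le> R}"
    then obtain a b where q: "q = of_int a + of_int b * z" and le: "cmod q \<le> R"
      unfolding lattice_def by blast
    have "\<bar>Im q\<bar> \<le> R" using abs_Im_le_cmod[of q] le by linarith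
    then have "\<bar>real_of_int b\<bar> * \<bar>Im z\<bar> \<le> R" by (simp add: q abs_mult)
    then have "\<bar>real_of_int b\<bar> \<le> R / \<bar>Im z\<bar>" using Im_nz by (simp add: field_simps)
    then have b: "\<bar>b\<bar> \<le> B" unfolding B_def by linarith
    have "real_of_int \<bar>b\<bar> * cmod z \<le> real_of_int B * cmod z"
      using b by (intro mult_right_mono) (simp_all only: of_int_le_iff norm_ge_zero)
    moreover have "cmod (of_int a) \<le> cmod q + cmod (of_int b * z)"
      using norm_triangle_ineq4[of q "of_int b * z"] by (simp add: q)
    ultimately have "\<bar>real_of_int a\<bar> \<le> R + real_of_int B * cmod z"
      using le by (simp add: norm_mult)
    then have "\<bar>a\<bar> \<le> A" unfolding A_def by linarith
    with b show "q \<in> (\<lambda>(a, b). of_int a + of_int b * z) ` ({- A..A} \<times> {- B..B})"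
      unfolding q by (intro image_eqI[of _ _ "(a, b)"]) auto
  qed
  then show ?thesis by (rule finite_subset) simp
qed

lemma lattice_approx: "\<exists>l\<in>lattice z. cmod (y - l) \<le> 1 + cmod z"
proof -
  define b where "b = Im y / Im z"
  define a where "a = Re y - b * Re z"
  have y: "y = of_real a + of_real b * z"
    using Im_nz by (simp add: complex_eq_iff a_def b_def)
  let ?l = "of_int \<lfloor>a\<rfloor> + of_int \<lfloor>b\<rfloor> * z"
  have "y - ?l = of_real (frac a) + of_real (frac b) * z"
    by (subst y) (simp add: frac_def algebra_simps)
  then have "cmod (y - ?l) \<le> \<bar>frac a\<bar> + \<bar>frac b\<bar> * cmod z"
    by (metis norm_triangle_ineq norm_mult norm_of_real)
  also have "\<dots> \<le> 1 + 1 * cmod z"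
    using frac_lt_1[of a] frac_lt_1[of b] frac_ge_0[of a] frac_ge_0[of b]
    by (intro add_mono mult_right_mono) auto
  finally show ?thesis unfolding lattice_def by auto
qed

text \<open>Since \<open>n = z * (D - z)\<close>, multiples of \<open>n\<close> are divisible by
  \<open>z\<close> in the lattice, so the residue of the integer coordinate modulo \<open>n\<close>
  serves as the digit.\<close>

lemma lattice_divide:
  assumes "l \<in> lattice z"
  obtains d q where "d < n" "q \<in> lattice z" "l = of_nat d + z * q"
proof -
  from assms obtain a b where l: "l = of_int a + of_int b * z"
    unfolding lattice_def by blast
  define q where "q = a div int n"
  define d where "d = nat (a mod int n)"
  have a: "a = int d + q * int n"
    using n_ge_2 by (simp add: d_def q_def)
  have "z * (of_int (b + q * D) + of_int (- q) * z) = of_int (q * int n) + of_int b * z"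
    by (subst lattice_mult) simp
  then have "l = of_nat d + z * (of_int (b + q * D) + of_int (- q) * z)"
    by (simp add: l a)
  moreover have "d < n" using n_ge_2 by (simp add: d_def nat_less_iff)
  moreover have "of_int (b + q * D) + of_int (- q) * z \<in> lattice z"
    unfolding lattice_def by blast
  ultimately show ?thesis using that by blast
qed

text \<open>Termination is not claimed: \<open>q\<close> may stay nonzero for every
  \<open>k\<close>, so this holds for all \<open>D\<close>.\<close>

lemma lattice_divide_power:
  assumes "l \<in> lattice z"
  shows "\<exists>e q. (\<forall>i. e i < n) \<and> q \<in> lattice z \<and> l = z ^ k * q + (\<Sum>i<k. of_nat (e i) * z ^ i)"
  using assms
proof (induction k arbitrary: l)
  case 0
  then show ?case using n_ge_2 by (intro exI[of _ "\<lambda>_. 0"] exI[of _ l]) auto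
next
  case (Suc k)
  obtain d l' where d: "d < n" "l' \<in> lattice z" "l = of_nat d + z * l'"
    using lattice_divide[OF Suc.prems] .
  obtain e q where e: "\<forall>i. e i < n" "q \<in> lattice z"
    "l' = z ^ k * q + (\<Sum>i<k. of_nat (e i) * z ^ i)"
    using Suc.IH[OF d(2)] by blast
  have "(\<Sum>i<Suc k. of_nat (case_nat d e i) * z ^ i) = of_nat d + z * (\<Sum>i<k. of_nat (e i) * z ^ i)"
    by (subst sum.lessThan_Suc_shift) (simp add: sum_distrib_left algebra_simps)
  then have "l = z ^ Suc k * q + (\<Sum>i<Suc k. of_nat (case_nat d e i) * z ^ i)"
    by (simp add: d(3) e(3) algebra_simps)
  moreover have "\<forall>i. case_nat d e i < n" using d e by (auto split: nat.split)
  ultimately show ?case using e(2) by blast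
qed

lemma finite_expansion_digits:
  assumes "finite_expansion (int n) D a b"
  shows "\<exists>m e. (\<forall>i. e i < n) \<and> of_int a + of_int b * z = (\<Sum>i<m. of_nat (e i) * z ^ i)"
  using assms
proof induction
  case zero
  show ?case using n_ge_2 by (intro exI[of _ 0] exI[of _ "\<lambda>_. 0"]) auto
next
  case (step b a)
  then obtain m e where e: "\<forall>i. e i < n"
    "of_int (b + (a div int n) * D) + of_int (- (a div int n)) * z = (\<Sum>i<m. of_nat (e i) * z ^ i)"
    by blast
  define q where "q = a div int n"
  define d where "d = nat (a mod int n)"
  have a: "a = int d + q * int n"
    using n_ge_2 by (simp add: d_def q_def)
  have "z * (of_int (b + q * D) + of_int (- q) * z) = of_int (q * int n) + of_int b * z"
    by (subst lattice_mult) simp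
  then have "of_int a + of_int b * z = of_nat d + z * (\<Sum>i<m. of_nat (e i) * z ^ i)"
    unfolding e(2)[folded q_def, symmetric] by (simp add: a)
  also have "\<dots> = (\<Sum>i<Suc m. of_nat (case_nat d e i) * z ^ i)"
    by (subst sum.lessThan_Suc_shift) (simp add: sum_distrib_left algebra_simps)
  finally have "of_int a + of_int b * z = (\<Sum>i<Suc m. of_nat (case_nat d e i) * z ^ i)" .
  moreover have "d < n" using n_ge_2 by (simp add: d_def nat_less_iff)
  then have "\<forall>i. case_nat d e i < n" using e by (auto split: nat.split)
  ultimately show ?case by blast
qed

lemma lattice_digits:
  assumes "D \<le> 1" "l \<in> lattice z"
  obtains m e where "\<forall>i. e i < n" "l = (\<Sum>i<m. of_nat (e i) * z ^ i)"
proof -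
  from assms(2) obtain a b where "l = of_int a + of_int b * z"
    unfolding lattice_def by blast
  moreover have "finite_expansion (int n) D a b"
    using assms(1) n_ge_2 abs_D_le by (intro finite_expansion_all) auto
  ultimately show ?thesis using finite_expansion_digits that by metis
qed

text \<open>Division by \<open>z\<close> reproduces this element, with the legitimate digit
  \<open>n + 1 - D\<close>. Stripping the lowest digit of a supposed expansion thus leaves a shorter
  expansion of the same element, down to the empty sum.\<close>

lemma not_digit_sum:
  assumes "2 \<le> D" "\<forall>i. e i < n"
  shows "of_int (1 - D) + z \<noteq> (\<Sum>i<m. of_nat (e i) * z ^ i)"
  using assms(2)
proof (induction m arbitrary: e)
  case 0
  have "of_int (1 - D) + of_int 1 * z \<noteq> of_int 0 + of_int 0 * z"
    unfolding lattice_inject by simp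
  then show ?case by simp
next
  case (Suc m)
  show ?case
  proof
    assume eq: "of_int (1 - D) + z = (\<Sum>i<Suc m. of_nat (e i) * z ^ i)"
    define y where "y = (\<Sum>i<m. of_nat (e (Suc i)) * z ^ i)"
    obtain p q where y: "y = of_int p + of_int q * z"
      using lattice_digit_sum[of "\<lambda>i. e (Suc i)" m] unfolding lattice_def y_def by blast
    have "of_int (1 - D) + z = of_nat (e 0) + z * y"
      unfolding eq y_def by (subst sum.lessThan_Suc_shift) (simp add: sum_distrib_left algebra_simps)
    then have "of_int (1 - D) + of_int 1 * z = of_int (int (e 0) - q * int n) + of_int (p + q * D) * z"
      unfolding y lattice_mult by (simp add: algebra_simps)
    then have pq: "1 - D = int (e 0) - q * int n" "1 = p + q * D"
      unfolding lattice_inject by simp_all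
    have e0: "int (e 0) < int n" using Suc.prems by simp
    \<comment> \<open>\<open>q * n = e 0 + D - 1\<close> lies strictly between \<open>0\<close> and
      \<open>2 * n\<close>.\<close>
    have "q = 1"
    proof -
      have "0 < q * int n" using pq(1) assms(1) by linarith
      then have "0 < q" using n_ge_2 by (simp add: zero_less_mult_iff)
      moreover have "q * int n < 2 * int n" using pq(1) abs_D_le e0 by linarith
      then have "q < 2" using n_ge_2 by (simp add: mult_less_cancel_right)
      ultimately show ?thesis by linarith
    qed
    with pq(2) have "p = 1 - D" by simp
    with \<open>q = 1\<close> have "y = of_int (1 - D) + z" by (simp add: y)
    then show False using Suc.IH[of "\<lambda>i. e (Suc i)"] Suc.prems unfolding y_def by auto
  qed
qed

section \<open>Fractional parts and the tile\<close>

text \<open>A geometric majorant independent of \<open>c\<close>: it gives absolute convergence and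
  also the uniform convergence behind \<open>compact_tile\<close>.\<close>

lemma norm_digit_le:
  assumes "c k < n"
  shows "cmod (of_nat (c k) / z ^ Suc k) \<le> real n * (1 / cmod z) ^ Suc k"
proof -
  have "cmod (of_nat (c k) / z ^ Suc k) = real (c k) * (1 / cmod z) ^ Suc k"
    by (simp add: norm_divide norm_mult norm_power power_divide)
  then show ?thesis using assms by (simp only:) (intro mult_right_mono, auto)
qed

lemma summable_geometric_bound: "summable (\<lambda>k. real n * (1 / cmod z) ^ Suc k)"
proof -
  have "norm (1 / cmod z) < 1" using cmod_gt_1 by (auto simp: divide_less_eq)
  then show ?thesis
    by (intro summable_mult) (simp add: summable_Suc_iff summable_geometric del: power_Suc)
qed

lemma summable_norm_digits:
  assumes "\<forall>k. c k < n"
  shows "summable (\<lambda>k. cmod (of_nat (c k) / z ^ Suc k))"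
  using norm_digit_le[of c] assms
  by (intro summable_comparison_test[OF _ summable_geometric_bound]) auto

lemma fractional_value_sums:
  assumes "\<forall>k. c k < n"
  shows "(\<lambda>k. of_nat (c k) / z ^ Suc k) sums fractional_value z c"
  unfolding fractional_value_def
  using summable_norm_cancel[OF summable_norm_digits[OF assms]] by (rule summable_sums)

lemma fractional_value_unfold:
  assumes "\<forall>k. c k < n"
  shows "z * fractional_value z c = of_nat (c 0) + fractional_value z (\<lambda>k. c (Suc k))"
proof -
  have "(\<lambda>k. z * (of_nat (c (Suc k)) / z ^ Suc (Suc k))) sums
      (z * fractional_value z c - z * (of_nat (c 0) / z ^ Suc 0))"
    using sums_mult[OF fractional_value_sums[OF assms], of z]
    by (subst sums_Suc_iff) (simp add: mult.commute)
  moreover have "z * (of_nat (c (Suc k)) / z ^ Suc (Suc k)) = of_nat (c (Suc k)) / z ^ Suc k" for k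
    using z_nz by simp
  ultimately have "(\<lambda>k. of_nat (c (Suc k)) / z ^ Suc k) sums (z * fractional_value z c - of_nat (c 0))"
    using z_nz by simp
  with fractional_value_sums[of "\<lambda>k. c (Suc k)"] assms show ?thesis
    using sums_unique2 by (metis (no_types, lifting) add.commute diff_add_cancel)
qed

lemma zero_in_tile: "0 \<in> tile n z"
  unfolding tile_def using n_ge_2
  by (auto simp: fractional_value_def intro!: exI[of _ "\<lambda>_. 0"])

lemma tile_cons:
  assumes "t \<in> tile n z" "d < n"
  shows "(of_nat d + t) / z \<in> tile n z"
proof -
  obtain c where c: "t = fractional_value z c" "\<forall>k. c k < n"
    using assms(1) unfolding tile_def by blast
  have digits: "\<forall>k. case_nat d c k < n" using c assms(2) by (auto split: nat.split)
  have "(of_nat d + t) / z = fractional_value z (case_nat d c)"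
    using fractional_value_unfold[OF digits] z_nz c(1) by (simp add: field_simps)
  then show ?thesis unfolding tile_def using digits by blast
qed

lemma tile_times: "(*) z ` tile n z = (\<Union>d<n. (+) (of_nat d) ` tile n z)"
proof safe
  fix t assume "t \<in> tile n z"
  then obtain c where c: "t = fractional_value z c" "\<forall>k. c k < n"
    unfolding tile_def by blast
  have "z * t = of_nat (c 0) + fractional_value z (\<lambda>k. c (Suc k))"
    unfolding c(1) by (rule fractional_value_unfold[OF c(2)])
  moreover have "fractional_value z (\<lambda>k. c (Suc k)) \<in> tile n z"
    unfolding tile_def using c(2) by blast
  ultimately show "z * t \<in> (\<Union>d<n. (+) (of_nat d) ` tile n z)"
    using c(2) by blast
next
  fix d t assume "d < n" "t \<in> tile n z"
  from tile_cons[OF this(2,1)] show "of_nat d + t \<in> (*) z ` tile n z"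
    using z_nz by (intro image_eqI[of _ _ "(of_nat d + t) / z"]) auto
qed

text \<open>The digits are put in front of those of \<open>t\<close> one by one, beginning with
  \<open>e 0\<close>; hence \<open>e (k - 1)\<close> ends up as the leading fractional
  digit.\<close>

lemma tile_append:
  assumes "t \<in> tile n z" "\<forall>i. e i < n"
  shows "((\<Sum>i<k. of_nat (e i) * z ^ i) + t) / z ^ k \<in> tile n z"
  using assms
proof (induction k arbitrary: e t)
  case 0
  then show ?case by simp
next
  case (Suc k)
  have "z * ((of_nat (e 0) + t) / z) = of_nat (e 0) + t" using z_nz by simp
  then have "(\<Sum>i<Suc k. of_nat (e i) * z ^ i) + t
      = z * ((\<Sum>i<k. of_nat (e (Suc i)) * z ^ i) + (of_nat (e 0) + t) / z)"
    unfolding distrib_left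
    by (subst sum.lessThan_Suc_shift) (simp add: sum_distrib_left mult_ac add_ac)
  then have "((\<Sum>i<Suc k. of_nat (e i) * z ^ i) + t) / z ^ Suc k
      = ((\<Sum>i<k. of_nat (e (Suc i)) * z ^ i) + (of_nat (e 0) + t) / z) / z ^ k"
    using z_nz by simp
  then show ?case
    using Suc.IH[of "(of_nat (e 0) + t) / z" "\<lambda>i. e (Suc i)"] tile_cons Suc.prems by simp
qed

text \<open>The digit sequences form a product of finite sets, compact by Tychonoff, and
  \<open>fractional_value z\<close> is a uniform limit of continuous partial sums on it.\<close>

lemma compact_tile: "compact (tile n z)"
proof -
  let ?K = "{c :: nat \<Rightarrow> nat. \<forall>k. c k < n}"
  have "compactin (product_topology (\<lambda>_. euclidean) UNIV) (PiE UNIV (\<lambda>_::nat. {..<n}))"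
    unfolding compactin_PiE by (auto intro: finite_imp_compact)
  moreover have "PiE UNIV (\<lambda>_::nat. {..<n}) = ?K" by auto
  ultimately have "compact ?K"
    by (simp add: euclidean_product_topology)
  moreover have "continuous_on ?K (fractional_value z)"
  proof (rule uniform_limit_theorem)
    show "uniform_limit ?K (\<lambda>m c. \<Sum>k<m. of_nat (c k) / z ^ Suc k) (fractional_value z) sequentially"
      unfolding fractional_value_def
      by (rule Weierstrass_m_test[OF _ summable_geometric_bound]) (use norm_digit_le in auto)
    have "continuous_on ?K (\<lambda>c. of_nat (c k) :: complex)" for k
      by (rule continuous_on_compose2[of UNIV of_nat])
        (auto intro!: continuous_on_product_coordinates continuous_on_subset[OF continuous_on_product_coordinates])
    then show "\<forall>\<^sub>F m in sequentially. continuous_on ?K (\<lambda>c. \<Sum>k<m. of_nat (c k) / z ^ Suc k)"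
      using z_nz
      by (intro always_eventually allI continuous_on_sum continuous_on_divide continuous_on_const) auto
  qed simp
  ultimately have "compact (fractional_value z ` ?K)"
    by (intro compact_continuous_image)
  moreover have "fractional_value z ` ?K = tile n z"
    unfolding tile_def by blast
  ultimately show ?thesis by simp
qed

text \<open>Rounding \<open>z ^ k * x\<close> to the lattice and dividing by \<open>z ^ k\<close>
  approximates \<open>x\<close> by points \<open>q + t\<close> with error tending to
  \<open>0\<close>. The \<open>q\<close> are bounded, so one value \<open>l\<close> recurs
  infinitely often, and \<open>x - l\<close> is a limit of points of the closed tile.\<close>

lemma tile_lattice_cover:
  obtains l t where "l \<in> lattice z" "t \<in> tile n z" "x = l + t"
proof -
  obtain M where M: "\<And>t. t \<in> tile n z \<Longrightarrow> cmod t \<le> M"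
    using compact_imp_bounded[OF compact_tile] unfolding bounded_iff by blast
  define R where "R = 1 + cmod z"
  have "\<exists>q\<in>lattice z. \<exists>t\<in>tile n z. cmod (x - (q + t)) \<le> R / cmod z ^ k" for k
  proof -
    obtain l where l: "l \<in> lattice z" "cmod (z ^ k * x - l) \<le> R"
      using lattice_approx unfolding R_def by blast
    obtain e q where e: "\<forall>i. e i < n" "q \<in> lattice z" "l = z ^ k * q + (\<Sum>i<k. of_nat (e i) * z ^ i)"
      using lattice_divide_power[OF l(1)] by blast
    \<comment> \<open>The summand \<open>0\<close> is the tile point to which
      \<open>tile_append\<close> is applied.\<close>
    define t where "t = ((\<Sum>i<k. of_nat (e i) * z ^ i) + 0) / z ^ k"
    have "t \<in> tile n z" unfolding t_def by (rule tile_append[OF zero_in_tile e(1)])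
    moreover have "x - (q + t) = (z ^ k * x - l) / z ^ k"
      using z_nz by (simp add: t_def e(3) field_simps)
    then have "cmod (x - (q + t)) \<le> R / cmod z ^ k"
      using l(2) z_nz by (simp add: norm_divide norm_power divide_right_mono)
    ultimately show ?thesis using e(2) by blast
  qed
  then obtain q t where q: "\<And>k. q k \<in> lattice z" and t: "\<And>k. t k \<in> tile n z"
    and le: "\<And>k. cmod (x - (q k + t k)) \<le> R / cmod z ^ k"
    by metis
  have "range q \<subseteq> {q \<in> lattice z. cmod q \<le> cmod x + R + M}"
  proof safe
    fix k
    show "q k \<in> lattice z" by (rule q)
    have "R / cmod z ^ k \<le> R / 1"
      using cmod_gt_1 by (intro divide_left_mono) (auto simp: R_def z_nz intro: one_le_power)
    then have "cmod (x - (q k + t k)) \<le> R" using le[of k] by simp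
    moreover have "q k = x - (x - (q k + t k)) - t k" by simp
    then have "cmod (q k) \<le> cmod x + cmod (x - (q k + t k)) + cmod (t k)"
      by (metis norm_triangle_ineq4 add_right_mono order_trans)
    ultimately show "cmod (q k) \<le> cmod x + R + M" using M[OF t[of k]] by linarith
  qed
  then have "finite (range q)" using finite_lattice_cball finite_subset by blast
  then obtain l where "infinite (q -` {l})" and l: "l \<in> range q"
    using inf_img_fin_dom'[of q UNIV] by (auto simp: vimage_def)
  then obtain r where r: "strict_mono (r :: nat \<Rightarrow> nat)" "\<And>i. q (r i) = l"
    using infinite_enumerate[of "q -` {l}"] by auto
  have "(\<lambda>k. R / cmod z ^ k) \<longlonglongrightarrow> 0"
    using tendsto_mult_right_zero[OF LIMSEQ_inverse_realpow_zero[OF cmod_gt_1], of R]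
    by (simp add: divide_inverse)
  then have "(\<lambda>k. x - (q k + t k)) \<longlonglongrightarrow> 0"
    by (rule Lim_null_comparison[rotated]) (use le in auto)
  from LIMSEQ_subseq_LIMSEQ[OF this r(1)]
  have "(\<lambda>i. x - (l + t (r i))) \<longlonglongrightarrow> 0" by (simp add: o_def r(2))
  from tendsto_diff[OF tendsto_const[of "x - l"] this]
  have "(\<lambda>i. t (r i)) \<longlonglongrightarrow> x - l" by simp
  moreover have "closed (tile n z)" using compact_tile by (rule compact_imp_closed)
  ultimately have "x - l \<in> tile n z" using t by (meson closed_sequentially)
  moreover have "l \<in> lattice z" using l q by auto
  ultimately show ?thesis using that[of l "x - l"] by simp
qed

section \<open>Measure of the tile and of its overlaps\<close>

text \<open>Otherwise countably many null translates would cover the plane.\<close>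

lemma not_negligible_tile: "\<not> negligible (tile n z)"
proof
  assume "negligible (tile n z)"
  then have "negligible ((+) l ` tile n z)" for l by (rule negligible_translation)
  then have "negligible (\<Union>l\<in>lattice z. (+) l ` tile n z)"
    by (intro negligible_countable_Union countable_image countable_lattice) auto
  moreover have "x \<in> (\<Union>l\<in>lattice z. (+) l ` tile n z)" for x
    by (rule tile_lattice_cover[of x]) blast
  then have "(\<Union>l\<in>lattice z. (+) l ` tile n z) = UNIV" by blast
  ultimately show False by simp
qed

text \<open>The union of the \<open>n\<close> translates is \<open>z\<close> times the tile and has
  \<open>n\<close> times its area, which is the sum of the areas of the translates. An overlap of
  positive area would make the union smaller.\<close>

lemma negligible_overlap:
  assumes "d < n" "d' < n" "d \<noteq> d'"
  shows "negligible ((+) (of_nat d) ` tile n z \<inter> (+) (of_nat d') ` tile n z)"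
proof -
  define A where "A d = (+) (of_nat d) ` tile n z" for d
  have A: "A d \<in> lmeasurable" for d
    unfolding A_def by (intro lmeasurable_compact compact_translation compact_tile)
  have mA: "measure lebesgue (A d) = measure lebesgue (tile n z)" for d
    unfolding A_def by (rule measure_translation)
  let ?m = "measure lebesgue"
  have "{..<n} = insert d ({..<n} - {d})" using assms by auto
  then have "(\<Union>d<n. A d) = (\<Union>i\<in>insert d ({..<n} - {d}). A i)" by simp
  also have "\<dots> \<subseteq> (\<Union>i\<in>{..<n} - {d}. A i) \<union> (A d - A d')"
    using assms by auto
  finally have sub: "(\<Union>d<n. A d) \<subseteq> (\<Union>i\<in>{..<n} - {d}. A i) \<union> (A d - A d')" .
  have "real n * ?m (tile n z) = ?m (\<Union>d<n. A d)"
    using measure_mult_complex[OF compact_tile, of z] by (simp add: tile_times cmod_sq A_def)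
  also have "\<dots> \<le> ?m ((\<Union>i\<in>{..<n} - {d}. A i) \<union> (A d - A d'))"
    using A sub by (intro measure_mono_fmeasurable) (auto intro!: fmeasurable.finite_UN fmeasurable.Diff fmeasurableD)
  also have "\<dots> \<le> ?m (\<Union>i\<in>{..<n} - {d}. A i) + ?m (A d - A d')"
    using A by (intro measure_Un_le) (auto intro!: fmeasurable.finite_UN fmeasurable.Diff fmeasurableD)
  also have "?m (\<Union>i\<in>{..<n} - {d}. A i) \<le> (\<Sum>i\<in>{..<n} - {d}. ?m (A i))"
    using A by (intro measure_UNION_le) (auto intro: fmeasurableD)
  also have "\<dots> = (real n - 1) * ?m (tile n z)"
    using assms(1) by (simp add: mA of_nat_diff)
  also have "?m (A d - A d') = ?m (tile n z) - ?m (A d \<inter> A d')"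
  proof -
    have "?m (A d - A d \<inter> A d') = ?m (A d) - ?m (A d \<inter> A d')"
      using A by (intro measurable_measure_Diff) (auto intro: fmeasurableD fmeasurable.Int)
    moreover have "A d - A d \<inter> A d' = A d - A d'" by blast
    ultimately show ?thesis by (simp add: mA)
  qed
  finally have "?m (A d \<inter> A d') \<le> 0" by (simp add: algebra_simps)
  then have "?m (A d \<inter> A d') = 0" using measure_nonneg by (rule antisym)
  moreover have "A d \<inter> A d' \<in> lmeasurable" using A by auto
  ultimately show ?thesis unfolding A_def by (simp add: negligible_iff_measure0)
qed

section \<open>Representations, their existence and almost everywhere uniqueness\<close>

text \<open>The two-sided series is cut at exponent \<open>j\<close> and \<open>z powi j\<close> is
  factored out. Existence uses \<open>j = 0\<close>; uniqueness cuts at the highest differing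
  digit.\<close>

lemma representation_has_sum:
  assumes "\<forall>i. a i < n" and zero: "\<forall>k\<ge>m. a (j + int k) = 0"
  shows "((\<lambda>i. of_nat (a i) * z powi i) has_sum
    z powi j * ((\<Sum>k<m. of_nat (a (j + int k)) * z ^ k) + fractional_value z (\<lambda>k. a (j - 1 - int k)))) UNIV"
proof -
  define f where "f i = of_nat (a i) * z powi i" for i
  have up: "f (j + int k) = z powi j * (of_nat (a (j + int k)) * z ^ k)" for k
    using z_nz by (simp add: f_def power_int_add)
  have "z powi (j - 1 - int k) = z powi j / z ^ Suc k" for k
  proof -
    have "z powi (j - 1 - int k) = z powi (j - int (Suc k))" by (simp add: algebra_simps)
    also have "\<dots> = z powi j / z powi int (Suc k)" using z_nz by (intro power_int_diff) auto
    finally show ?thesis by (simp only: power_int_of_nat)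
  qed
  then have down: "f (j - 1 - int k) = z powi j * (of_nat (a (j - 1 - int k)) / z ^ Suc k)" for k
    by (simp add: f_def)
  have "((f \<circ> (\<lambda>k. j + int k)) has_sum z powi j * (\<Sum>k<m. of_nat (a (j + int k)) * z ^ k)) UNIV"
  proof (rule has_sum_finite_neutralI[of "{..<m}"])
    show "z powi j * (\<Sum>k<m. of_nat (a (j + int k)) * z ^ k)
        = (\<Sum>k<m. (f \<circ> (\<lambda>k. j + int k)) k)"
      by (simp add: up sum_distrib_left)
  qed (use zero in \<open>auto simp: f_def\<close>)
  then have "(f has_sum z powi j * (\<Sum>k<m. of_nat (a (j + int k)) * z ^ k)) (range (\<lambda>k. j + int k))"
    by (subst has_sum_reindex) (auto simp: inj_on_def)
  moreover have "range (\<lambda>k. j + int k) = {j..}"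
  proof safe
    fix i assume "j \<le> i"
    then show "i \<in> range (\<lambda>k. j + int k)" by (intro image_eqI[of _ _ "nat (i - j)"]) auto
  qed auto
  moreover have "((f \<circ> (\<lambda>k. j - 1 - int k)) has_sum
      z powi j * fractional_value z (\<lambda>k. a (j - 1 - int k))) UNIV"
  proof -
    have "((\<lambda>k. of_nat (a (j - 1 - int k)) / z ^ Suc k) has_sum
        fractional_value z (\<lambda>k. a (j - 1 - int k))) UNIV"
      using assms(1) by (intro norm_summable_imp_has_sum summable_norm_digits fractional_value_sums) auto
    from has_sum_cmult_right[OF this] show ?thesis by (simp only: o_def down)
  qed
  then have "(f has_sum z powi j * fractional_value z (\<lambda>k. a (j - 1 - int k)))
      (range (\<lambda>k. j - 1 - int k))"
    by (subst has_sum_reindex) (auto simp: inj_on_def)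
  moreover have "range (\<lambda>k. j - 1 - int k) = {..<j}"
  proof safe
    fix i assume "i < j"
    then show "i \<in> range (\<lambda>k. j - 1 - int k)" by (intro image_eqI[of _ _ "nat (j - 1 - i)"]) auto
  qed auto
  ultimately have "(f has_sum z powi j * (\<Sum>k<m. of_nat (a (j + int k)) * z ^ k)
      + z powi j * fractional_value z (\<lambda>k. a (j - 1 - int k))) ({j..} \<union> {..<j})"
    by (intro has_sum_Un_disjoint) auto
  moreover have "{j..} \<union> {..<j} = (UNIV :: int set)" by auto
  ultimately show ?thesis by (simp add: f_def[abs_def] distrib_left)
qed

text \<open>Valid for all large \<open>m\<close>, so that two representations of the same point can
  be cut with a common \<open>m\<close>.\<close>

lemma representation_split:
  assumes "is_representation n z x a"
  shows "\<forall>\<^sub>F m in sequentially. x = z powi j *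
    ((\<Sum>k<m. of_nat (a (j + int k)) * z ^ k) + fractional_value z (\<lambda>k. a (j - 1 - int k)))"
proof -
  obtain N where digits: "\<forall>i. a i < n" and N: "\<forall>i>N. a i = 0"
    and sum: "((\<lambda>i. of_nat (a i) * z powi i) has_sum x) UNIV"
    using assms unfolding is_representation_def by auto
  have "x = z powi j *
      ((\<Sum>k<m. of_nat (a (j + int k)) * z ^ k) + fractional_value z (\<lambda>k. a (j - 1 - int k)))"
    if "nat (N + 1 - j) \<le> m" for m
  proof (rule has_sum_unique[OF sum representation_has_sum[OF digits]])
    show "\<forall>k\<ge>m. a (j + int k) = 0" using that N by auto
  qed
  then show ?thesis unfolding eventually_sequentially by blast
qed

lemma representation_digits:
  assumes "is_representation n z x a"
  obtains m e c where "\<forall>i. e i < n" "\<forall>k. c k < n"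
    "x = (\<Sum>i<m. of_nat (e i) * z ^ i) + fractional_value z c"
proof -
  have digits: "\<forall>i. a i < n" using assms unfolding is_representation_def by auto
  obtain m where "x = z powi 0 *
      ((\<Sum>k<m. of_nat (a (0 + int k)) * z ^ k) + fractional_value z (\<lambda>k. a (0 - 1 - int k)))"
    using eventually_happens'[OF _ representation_split[OF assms, of 0]] by auto
  then show ?thesis
    using that[of "\<lambda>k. a (0 + int k)" "\<lambda>k. a (0 - 1 - int k)" m] digits by simp
qed

text \<open>The converse of \<open>representation_digits\<close>; \<open>c k\<close> sits at
  exponent \<open>- 1 - k\<close>.\<close>

lemma representation_of_digits:
  assumes "\<forall>i. e i < n" "\<forall>k. c k < n"
  shows "is_representation n z ((\<Sum>i<m. of_nat (e i) * z ^ i) + fractional_value z c)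
    (\<lambda>i. if i < 0 then c (nat (- 1 - i)) else if i < int m then e (nat i) else 0)"
    (is "is_representation n z ?x ?a")
proof -
  have digits: "\<forall>i. ?a i < n" using assms n_ge_2 by auto
  have "((\<lambda>i. of_nat (?a i) * z powi i) has_sum z powi 0 *
      ((\<Sum>k<m. of_nat (?a (0 + int k)) * z ^ k) + fractional_value z (\<lambda>k. ?a (0 - 1 - int k)))) UNIV"
    by (rule representation_has_sum[OF digits]) auto
  moreover have "(\<lambda>k. ?a (0 - 1 - int k)) = c" by auto
  moreover have "(\<Sum>k<m. of_nat (?a (0 + int k)) * z ^ k) = (\<Sum>i<m. of_nat (e i) * z ^ i)"
    by (intro sum.cong) auto
  ultimately have "((\<lambda>i. of_nat (?a i) * z powi i) has_sum ?x) UNIV" by simp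
  moreover have "\<exists>N. \<forall>i>N. ?a i = 0" by (rule exI[of _ "int m"]) auto
  ultimately show ?thesis using digits unfolding is_representation_def atLeastLessThan_iff by blast
qed

lemma representation_exists:
  assumes "D \<le> 1"
  shows "\<exists>a. is_representation n z x a"
proof -
  obtain l t where lt: "l \<in> lattice z" "t \<in> tile n z" "x = l + t"
    by (rule tile_lattice_cover)
  obtain m e where "\<forall>i. e i < n" "l = (\<Sum>i<m. of_nat (e i) * z ^ i)"
    using lattice_digits[OF assms lt(1)] .
  moreover obtain c where "t = fractional_value z c" "\<forall>k. c k < n"
    using lt(2) unfolding tile_def by blast
  ultimately show ?thesis unfolding lt(3) using representation_of_digits by blast
qed

text \<open>Two different representations of \<open>x\<close> have a highest position \<open>j\<close> at which they differ.
  After removing the common part above it, \<open>x\<close> lies in the overlap of two translates of the tile,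
  up to the factor \<open>z\<^sup>j\<close> and a lattice translation.\<close>
lemma representation_unique_ae:
  "\<exists>S. negligible S \<and>
    (\<forall>x a b. x \<notin> S \<longrightarrow> is_representation n z x a \<longrightarrow> is_representation n z x b \<longrightarrow> a = b)"
proof -
  define A where "A d = (+) (of_nat d) ` tile n z" for d
  \<comment> \<open>\<open>l\<close> will be the common part above exponent \<open>j\<close>, and
    \<open>d\<close>, \<open>d'\<close> the two digits at \<open>j\<close>.\<close>
  define F where "F = (\<lambda>(j :: int, l, d, d'). (*) (z powi j) ` (+) l ` (A d \<inter> A d'))"
  define I where "I = (UNIV :: int set) \<times> lattice z \<times> {(d, d'). d < n \<and> d' < n \<and> d \<noteq> d'}"
  have cA: "compact (A d)" for d
    unfolding A_def by (intro compact_translation compact_tile)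
  have "negligible (F i)" if "i \<in> I" for i
  proof -
    obtain j l d d' where eq: "i = (j, l, d, d')" by (cases i) auto
    with that have i: "i = (j, l, d, d')" "d < n" "d' < n" "d \<noteq> d'"
      unfolding I_def by auto
    have "negligible ((+) l ` (A d \<inter> A d'))"
      unfolding A_def using negligible_overlap i by (intro negligible_translation) auto
    moreover have c: "compact ((+) l ` (A d \<inter> A d'))"
      using cA by (intro compact_translation compact_Int)
    moreover have "compact ((*) (z powi j) ` (+) l ` (A d \<inter> A d'))"
      by (intro compact_continuous_image[OF _ c] continuous_intros)
    ultimately show ?thesis
      using measure_mult_complex[OF c, of "z powi j"]
      by (simp add: i F_def negligible_iff_measure lmeasurable_compact)
  qed
  moreover have "countable I"
    unfolding I_def using countable_lattice by (intro countable_SIGMA) auto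
  ultimately have "negligible (\<Union>i\<in>I. F i)"
    by (intro negligible_countable_Union countable_image) auto
  moreover have "a = b"
    if "x \<notin> (\<Union>i\<in>I. F i)" "is_representation n z x a" "is_representation n z x b" for x a b
  proof (rule ccontr)
    assume "a \<noteq> b"
    note rep = that
    obtain N where N: "\<forall>i>N. a i = 0 \<and> b i = 0"
    proof -
      obtain M M' where "\<forall>i>M. a i = 0" "\<forall>i>M'. b i = 0"
        using rep(2,3) unfolding is_representation_def by auto
      then show ?thesis by (intro that[of "max M M'"]) auto
    qed
    obtain i0 where i0: "a i0 \<noteq> b i0" using \<open>a \<noteq> b\<close> by auto
    have digits: "a i < n" "b i < n" for i
      using rep unfolding is_representation_def by auto
    \<comment> \<open>Differences may continue indefinitely downwards; cutting at \<open>i0\<close>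
      makes the set finite while keeping it nonempty.\<close>
    define J where "J = {i. i0 \<le> i \<and> a i \<noteq> b i}"
    have "J \<subseteq> {i0..N}"
    proof
      fix i assume "i \<in> J"
      then have "i0 \<le> i" "a i \<noteq> b i" by (auto simp: J_def)
      moreover from this N have "i \<le> N" by (metis not_le)
      ultimately show "i \<in> {i0..N}" by simp
    qed
    then have "finite J" by (rule finite_subset) simp
    have "i0 \<in> J" using i0 by (simp add: J_def)
    define j where "j = Max J"
    have "j \<in> J" unfolding j_def using \<open>finite J\<close> \<open>i0 \<in> J\<close> by (intro Max_in) auto
    then have j: "a j \<noteq> b j" "i0 \<le> j" by (auto simp: J_def)
    have above: "a i = b i" if "j < i" for i
    proof (rule ccontr)
      assume "a i \<noteq> b i"
      then have "i \<in> J" using that j(2) by (simp add: J_def)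
      then show False using Max_ge[OF \<open>finite J\<close>] that unfolding j_def by fastforce
    qed
    define e where "e k = a (j + 1 + int k)" for k
    have split: "\<exists>y\<in>tile n z. \<forall>\<^sub>F m in sequentially.
        x = z powi j * (z * (\<Sum>k<m. of_nat (e k) * z ^ k) + (of_nat (c j) + y))"
      if c: "is_representation n z x c" "\<And>i. j < i \<Longrightarrow> c i = a i" for c
    proof
      have "\<forall>k. c (j - 1 - int k) < n" using c(1) unfolding is_representation_def by auto
      then show "fractional_value z (\<lambda>k. c (j - 1 - int k)) \<in> tile n z"
        unfolding tile_def by blast
      \<comment> \<open>With \<open>Suc m\<close> terms, exactly \<open>m\<close> shared digits
        remain once the digit at \<open>j\<close> is split off.\<close>
      have "(\<Sum>k<Suc m. of_nat (c (j + int k)) * z ^ k)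
          = of_nat (c j) + z * (\<Sum>k<m. of_nat (e k) * z ^ k)" for m
        by (subst sum.lessThan_Suc_shift)
          (simp add: c(2) e_def sum_distrib_left mult_ac add_ac)
      then show "\<forall>\<^sub>F m in sequentially. x = z powi j * (z * (\<Sum>k<m. of_nat (e k) * z ^ k)
          + (of_nat (c j) + fractional_value z (\<lambda>k. c (j - 1 - int k))))"
        using representation_split[OF c(1), of j]
        by (subst (asm) eventually_sequentially_Suc[symmetric]) (simp add: add_ac)
    qed
    obtain y where y: "y \<in> tile n z" "\<forall>\<^sub>F m in sequentially.
        x = z powi j * (z * (\<Sum>k<m. of_nat (e k) * z ^ k) + (of_nat (a j) + y))"
      using split[OF rep(2)] by blast
    obtain y' where y': "y' \<in> tile n z" "\<forall>\<^sub>F m in sequentially.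
        x = z powi j * (z * (\<Sum>k<m. of_nat (e k) * z ^ k) + (of_nat (b j) + y'))"
      using split[OF rep(3)] above by auto
    obtain m where
      m: "x = z powi j * (z * (\<Sum>k<m. of_nat (e k) * z ^ k) + (of_nat (a j) + y))"
        "x = z powi j * (z * (\<Sum>k<m. of_nat (e k) * z ^ k) + (of_nat (b j) + y'))"
      using eventually_happens'[OF sequentially_bot eventually_conj[OF y(2) y'(2)]] by blast
    have "of_nat (a j) + y = of_nat (b j) + y'"
      using trans[OF m(1)[symmetric] m(2)] z_nz by simp
    then have "of_nat (a j) + y \<in> A (a j) \<inter> A (b j)"
      unfolding A_def using y(1) y'(1) by (metis IntI imageI)
    then have "x \<in> F (j, z * (\<Sum>k<m. of_nat (e k) * z ^ k), a j, b j)"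
      unfolding F_def m(1) by auto
    moreover have "(j, z * (\<Sum>k<m. of_nat (e k) * z ^ k), a j, b j) \<in> I"
      unfolding I_def using digits j lattice_times[OF lattice_digit_sum] by auto
    ultimately show False using rep(1) by blast
  qed
  ultimately show ?thesis by blast
qed

lemma proper:
  assumes "D \<le> 1"
  shows "proper_system n z"
  using representation_exists[OF assms] representation_unique_ae
  unfolding proper_system_def negligible_iff_null_sets by blast

section \<open>The base \<open>- z\<close> and the failure of existence for
  \<open>D \<ge> 2\<close>\<close>

lemma quadratic_base_uminus: "quadratic_base n (- z) (- D)"
  using n_ge_2 Im_nz cmod_sq square by unfold_locales auto

lemma lattice_uminus: "lattice (- z) = lattice z"
proof -
  have "lattice (- w) \<subseteq> lattice w" for w
  proof
    fix x assume "x \<in> lattice (- w)"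
    then obtain a b where "x = of_int a + of_int b * (- w)" unfolding lattice_def by blast
    then have "x = of_int a + of_int (- b) * w" by simp
    then show "x \<in> lattice w" unfolding lattice_def by blast
  qed
  from this[of z] this[of "- z"] show ?thesis by auto
qed

text \<open>Complementing the digits at odd exponents turns base \<open>z\<close> into base \<open>- z\<close>, up to a
  translation.\<close>
lemma fractional_value_uminus:
  fixes c
  defines "c' \<equiv> \<lambda>k. if even k then n - 1 - c k else c k"
  assumes "\<forall>k. c k < n"
  shows "fractional_value (- z) c' =
    fractional_value z c - fractional_value z (\<lambda>k. if even k then n - 1 else 0)"
proof -
  interpret neg: quadratic_base n "- z" "- D" by (rule quadratic_base_uminus)
  have "\<forall>k. c' k < n" using assms n_ge_2 by (auto simp: c'_def less_imp_diff_less)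
  then have "(\<lambda>k. of_nat (c' k) / (- z) ^ Suc k) sums fractional_value (- z) c'"
    by (rule neg.fractional_value_sums)
  moreover have "(\<lambda>k. of_nat (c k) / z ^ Suc k - of_nat (if even k then n - 1 else 0) / z ^ Suc k) sums
      (fractional_value z c - fractional_value z (\<lambda>k. if even k then n - 1 else 0))"
    using assms n_ge_2 by (intro sums_diff fractional_value_sums) auto
  moreover have "of_nat (c' k) / (- z) ^ Suc k
      = of_nat (c k) / z ^ Suc k - of_nat (if even k then n - 1 else 0) / z ^ Suc k" for k
  proof (cases "even k")
    \<comment> \<open>Index \<open>k\<close> belongs to exponent \<open>- (k + 1)\<close>, so even
      \<open>k\<close> means an odd exponent and a change of sign.\<close>
    case True
    have "c k \<le> n - 1" using assms n_ge_2 by (metis Suc_diff_1 less_Suc_eq_le not_less_zero not_gr_zero)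
    then have "of_nat (c' k) = (of_nat (n - 1) - of_nat (c k) :: complex)"
      using of_nat_diff[of "c k" "n - 1", where ?'a = complex] True by (simp only: c'_def if_True)
    moreover have "(- z) ^ Suc k = - (z ^ Suc k)" using True by simp
    ultimately show ?thesis using True by (simp add: diff_divide_distrib del: power_Suc)
  next
    case False
    then have "(- z) ^ Suc k = z ^ Suc k" by (intro power_minus_even) simp
    then show ?thesis using False by (simp add: c'_def)
  qed
  ultimately show ?thesis using sums_unique2 by auto
qed

text \<open>A representation of \<open>x0 + t + \<kappa>\<close> in base \<open>z\<close>, with
  integer part \<open>l\<close>, turns into one of \<open>x0 + t\<close> in base \<open>- z\<close>
  with the same \<open>l\<close>. As \<open>- D \<le> 1\<close>, both \<open>l\<close> and
  \<open>x0\<close> have finite expansions in base \<open>- z\<close>. Uniqueness there forces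
  \<open>x0 = l\<close>, contradicting \<open>not_digit_sum\<close>.\<close>

lemma not_proper:
  assumes "2 \<le> D"
  shows "\<not> proper_system n z"
proof
  assume "proper_system n z"
  interpret neg: quadratic_base n "- z" "- D" by (rule quadratic_base_uminus)
  have neg_digits: "\<exists>m e. (\<forall>i. e i < n) \<and> l = (\<Sum>i<m. of_nat (e i) * (- z) ^ i)"
    if "l \<in> lattice z" for l
  proof -
    have "- D \<le> 1" "l \<in> lattice (- z)" using that assms by (simp_all add: lattice_uminus)
    from neg.lattice_digits[OF this] show ?thesis by metis
  qed
  define \<kappa> where "\<kappa> = fractional_value z (\<lambda>k. if even k then n - 1 else 0)"
  define x0 where "x0 = of_int (1 - D) + z"
  have "x0 = of_int (1 - D) + of_int 1 * z" by (simp add: x0_def)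
  then have x0: "x0 \<in> lattice z" unfolding lattice_def by blast
  obtain S where S: "negligible S"
    "\<And>x a b. x \<notin> S \<Longrightarrow> is_representation n (- z) x a \<Longrightarrow> is_representation n (- z) x b \<Longrightarrow> a = b"
    using neg.representation_unique_ae by blast
  \<comment> \<open>Shifting \<open>S\<close> by \<open>- x0\<close> yields a tile point
    \<open>t\<close> for which \<open>x0 + t\<close> avoids \<open>S\<close>.\<close>
  have "negligible ((+) (- x0) ` S)" using S(1) by (rule negligible_translation)
  with neg.not_negligible_tile have "\<not> tile n (- z) \<subseteq> (+) (- x0) ` S"
    using negligible_subset by blast
  then obtain t where t: "t \<in> tile n (- z)" "t \<notin> (+) (- x0) ` S" by blast
  have notS: "x0 + t \<notin> S"
  proof
    assume "x0 + t \<in> S"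
    then have "- x0 + (x0 + t) \<in> (+) (- x0) ` S" by (rule imageI)
    then show False using t(2) by simp
  qed
  obtain c where c: "\<forall>k. c k < n" "t = fractional_value (- z) c"
    using t(1) unfolding tile_def by blast
  obtain a where "is_representation n z (x0 + t + \<kappa>) a"
    using \<open>proper_system n z\<close> unfolding proper_system_def by blast
  then obtain m e g where e: "\<forall>i. e i < n" and g: "\<forall>k. g k < n"
    and eq: "x0 + t + \<kappa> = (\<Sum>i<m. of_nat (e i) * z ^ i) + fractional_value z g"
    by (rule representation_digits)
  define l where "l = (\<Sum>i<m. of_nat (e i) * z ^ i)"
  define g' where "g' k = (if even k then n - 1 - g k else g k)" for k
  have g': "\<forall>k. g' k < n" using g n_ge_2 by (auto simp: g'_def)
  have eq': "x0 + t = l + fractional_value (- z) g'"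
  proof -
    have "x0 + t = l + fractional_value z g - \<kappa>"
      using eq unfolding l_def by (metis add_diff_cancel_right')
    also have "\<dots> = l + fractional_value (- z) g'"
      using fractional_value_uminus[OF g] unfolding g'_def[abs_def] \<kappa>_def by simp
    finally show ?thesis .
  qed
  have "l \<in> lattice z" unfolding l_def by (rule lattice_digit_sum)
  then obtain m1 e1 where l: "\<forall>i. e1 i < n" "l = (\<Sum>i<m1. of_nat (e1 i) * (- z) ^ i)"
    using neg_digits by blast
  obtain m2 e2 where x: "\<forall>i. e2 i < n" "x0 = (\<Sum>i<m2. of_nat (e2 i) * (- z) ^ i)"
    using neg_digits[OF x0] by blast
  have r1: "is_representation n (- z) (x0 + t)
      (\<lambda>i. if i < 0 then g' (nat (- 1 - i)) else if i < int m1 then e1 (nat i) else 0)"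
    unfolding eq' l(2) using l(1) g' by (rule neg.representation_of_digits)
  have r2: "is_representation n (- z) (x0 + t)
      (\<lambda>i. if i < 0 then c (nat (- 1 - i)) else if i < int m2 then e2 (nat i) else 0)"
    unfolding c(2) x(2) using x(1) c(1) by (rule neg.representation_of_digits)
  have same: "(if i < 0 then g' (nat (- 1 - i)) else if i < int m1 then e1 (nat i) else 0)
      = (if i < 0 then c (nat (- 1 - i)) else if i < int m2 then e2 (nat i) else 0)" for i
    using fun_cong[OF S(2)[OF notS r1 r2], of i] .
  \<comment> \<open>Agreement at negative exponents suffices: equal fractional parts force equal
    integer parts.\<close>
  have "g' k = c k" for k using same[of "- 1 - int k"] by simp
  then have "g' = c" by (rule ext)
  with eq' have "x0 = l" by (simp add: c(2))
  then show False
    using not_digit_sum[OF assms e, of m] unfolding x0_def l_def by simp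
qed

end

theorem theorem8:
  fixes n :: nat and z :: complex and D :: real
  assumes "n \<ge> 2"
    and "z \<notin> \<real>"
    and "(cmod z)\<^sup>2 = real n"
    and "\<exists>p q :: int. z\<^sup>2 = of_int p + z * of_int q"
    and "D = 2 * Re z"
  shows "D \<in> \<int> \<and> - 2 * sqrt (real n) < D \<and> D < 2 * sqrt (real n) \<and>
    z\<^sup>2 = of_real D * z - of_nat n \<and>
    (proper_system n z \<longleftrightarrow> D \<le> 1)"
proof -
  have Im: "Im z \<noteq> 0" using assms(2) by (simp add: complex_is_Real_iff)
  obtain p q :: int where pq: "z\<^sup>2 = of_int p + z * of_int q" using assms(4) by blast
  \<comment> \<open>The imaginary part of \<open>z\<^sup>2\<close> is
    \<open>2 * Re z * Im z\<close>, that is \<open>D * Im z\<close>.\<close>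
  from arg_cong[OF pq, of Im] have D: "D = of_int q"
    using Im assms(5) by (simp add: power2_eq_square)
  \<comment> \<open>\<open>z\<close> is a root of the polynomial with trace \<open>z + cnj z\<close>
    and norm \<open>z * cnj z\<close>.\<close>
  have sq: "z\<^sup>2 = of_real D * z - of_nat n"
  proof -
    have "of_nat n = z * cnj z"
      using assms(3) by (metis complex_norm_square of_real_of_nat_eq)
    moreover have "of_real D = z + cnj z"
      using assms(5) by (simp add: complex_add_cnj)
    ultimately show ?thesis by (simp add: power2_eq_square algebra_simps)
  qed
  interpret quadratic_base n z q
    using assms(1,3) Im sq D by unfold_locales auto
  have "\<bar>D\<bar> < 2 * sqrt (real n)"
  proof -
    have "\<bar>Re z\<bar> < cmod z"
      by (rule power2_less_imp_less) (use Im in \<open>simp_all add: cmod_power2\<close>)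
    moreover have "cmod z = sqrt (real n)" using assms(3) by (metis norm_ge_zero real_sqrt_unique)
    ultimately show ?thesis using assms(5) by simp
  qed
  moreover have "proper_system n z \<longleftrightarrow> D \<le> 1"
    using proper not_proper D by (cases "q \<le> 1") auto
  ultimately show ?thesis using D sq by auto
qed

end
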